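(* Suppose that the Regularity assumption of the context holds with $m\ge1$, and use the same regularity constants $\underline f,G,L_f,M,L_c,\sigma$ for both methods NR-LALM and NR-LALM+SOC. (a) Every tuple $(\Delta,\beta,\rho,\Lambda)$ of positive numbers satisfying the base inequalities (for NR-LALM) also satisfies the corrected inequalities (for NR-LALM+SOC). (b) Consequently, under global regularity ($\mathcal U=\mathbb R^n$), any parameters and initial pair certified for NR-LALM are also certified for NR-LALM+SOC. (c) This inclusion can be strict: there exist a globally regular scalar problem ($n=m=1$, $\mathcal U=\mathbb R$, with regularity constants used for both methods) and fixed $(\beta,\rho,x_0,\lambda_0)$ with $\beta,\rho>0$ for which the NR-LALM+SOC conditions (corrected inequalities together with the initialization conditions) hold for some positive $(\Delta,\Lambda)$, whereas the NR-LALM conditions (base inequalities together with the initialization conditions) admit no positive auxiliary pair $(\widehat\Delta,\widehat\Lambda)$.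
   Context: Norms are Euclidean for vectors and spectral for matrices; for $f:\mathbb R^n\to\mathbb R$, $c:\mathbb R^n\to\mathbb R^m$, $\nabla c(x):=(\nabla c_1(x),\ldots,\nabla c_m(x))\in\mathbb R^{n\times m}$. Regularity assumption: $f$ and $c$ are continuously differentiable on a nonempty open set $\mathcal U\subseteq\mathbb R^n$, and there are $\underline f\in\mathbb R$ and positive constants $G,L_f,M,L_c,\sigma$ such that for all $x,y\in\mathcal U$ and $u\in\mathbb R^m$: (i) $f(x)\ge\underline f$, $\|\nabla f(x)\|\le G$, $\|\nabla f(x)-\nabla f(y)\|\le L_f\|x-y\|$; (ii) $\|\nabla c(x)\|\le M$, $\|\nabla c(x)-\nabla c(y)\|\le L_c\|x-y\|$; (iii) $\|\nabla c(x)u\|\ge\sigma\|u\|$. Base inequalities (NR-LALM): with $\kappa_{\mathrm{lin}}:=L_c/2$ and $$C_{\mathrm{mod}}:=\frac{L_f}{2}+\kappa_{\mathrm{lin}}(3\Lambda+\rho M\Delta)+\frac{\rho}{2}\kappa_{\mathrm{lin}}^2\Delta^2,\quad A_p:=\beta+\rho M\kappa_{\mathrm{lin}}\Delta,\quad B_p:=A_p+L_f+L_c\Lambda,\quad C_{\lambda,p}:=\frac{4}{\sigma^2}\max\{A_p^2,B_p^2\},$$ $$\Lambda\ge\frac{G+\beta\Delta+\rho M\kappa_{\mathrm{lin}}\Delta^2}{\sigma},\quad \frac{G}{\beta}+\frac{3M\Lambda}{\beta+\rho\sigma^2}\le\Delta,\quad C_{\mathrm{mod}}\le\frac{3\beta}{8},\quad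 \rho\ge\frac{8C_{\lambda,p}}{\beta}.$$ Corrected inequalities (NR-LALM+SOC): with $\kappa_q:=L_c/(2\sigma)$, $\kappa_d:=L_c^3/(8\sigma^2)$, $\chi^{\mathrm{cor}}:=1+\kappa_q\Delta$ and $$C_{\mathrm{mod}}^{\mathrm{cor}}:=G\kappa_q+\frac{L_f}{2}(\chi^{\mathrm{cor}})^2+\kappa_d\Delta^2(3\Lambda+\rho M\Delta)+\frac{\rho}{2}\kappa_d^2\Delta^6,\quad A_p^{\mathrm{cor}}:=\beta+\rho M\kappa_d\Delta^3,$$ $$B_p^{\mathrm{cor}}:=A_p^{\mathrm{cor}}+(L_f+L_c\Lambda)\chi^{\mathrm{cor}},\quad C_{\lambda,p}^{\mathrm{cor}}:=\frac4{\sigma^2}\max\{(A_p^{\mathrm{cor}})^2,(B_p^{\mathrm{cor}})^2\},$$ $$\Lambda\ge\frac{G+\beta\Delta+\rho M\kappa_d\Delta^4}{\sigma},\quad \frac{G}{\beta}+\frac{3M\Lambda}{\beta+\rho\sigma^2}\le\Delta,\quad C_{\mathrm{mod}}^{\mathrm{cor}}\le\frac{3\beta}{8},\quad \rho\ge\frac{8C_{\lambda,p}^{\mathrm{cor}}}{\beta}.$$ Initialization conditions (same for both methods): $\|\lambda_0\|\le\Lambda$ and $\rho\|c(x_0)\|\le\Lambda$. Under global regularity, parameters $(\Delta,\beta,\rho,\Lambda)$ and an initial pair $(x_0,\lambda_0)$ are "certified" for a method if that method's four inequalities and the initialization conditions hold (the localization requirements, namely that certain neighborhoods lie in $\mathcal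 U$, are automatic when $\mathcal U=\mathbb R^n$). *)

theory Defs
  imports "HOL-Analysis.Analysis"
begin

text \<open>The gradient is meaningful only where the function is differentiable, in which case it is
  the unique vector \<open>D\<close> with \<open>GDERIV f x :> D\<close>.\<close>

definition grad :: "(real^'n \<Rightarrow> real) \<Rightarrow> real^'n \<Rightarrow> real^'n" where
  "grad f x = (THE D. GDERIV f x :> D)"

text \<open>The \<open>n \<times> m\<close> matrix whose \<open>j\<close>-th column is the gradient of the \<open>j\<close>-th component
  (the transpose of the Jacobian).\<close>

definition grad_mat :: "(real^'n \<Rightarrow> real^'m) \<Rightarrow> real^'n \<Rightarrow> real^'m^'n" where
  "grad_mat c x = (\<chi> i j. grad (\<lambda>y. c y $ j) x $ i)"

text \<open>The library norm on the type \<open>real^'m^'n\<close> is the Frobenius norm, hence a separate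
  spectral norm.\<close>

definition spectral_norm :: "real^'m^'n \<Rightarrow> real" where
  "spectral_norm A = onorm ((*v) A)"

definition C1_on :: "(real^'n) set \<Rightarrow> (real^'n \<Rightarrow> real) \<Rightarrow> bool" where
  "C1_on U f \<longleftrightarrow> (\<forall>x\<in>U. f differentiable (at x)) \<and> continuous_on U (grad f)"

definition regularity ::
  "(real^'n \<Rightarrow> real) \<Rightarrow> (real^'n \<Rightarrow> real^'m) \<Rightarrow> (real^'n) set \<Rightarrow>
   real \<Rightarrow> real \<Rightarrow> real \<Rightarrow> real \<Rightarrow> real \<Rightarrow> real \<Rightarrow> bool" where
  "regularity f c U f_low G L_f M L_c \<sigma> \<longleftrightarrow>
     open U \<and> U \<noteq> {} \<and> C1_on U f \<and> (\<forall>j. C1_on U (\<lambda>x. c x $ j)) \<and>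
     G > 0 \<and> L_f > 0 \<and> M > 0 \<and> L_c > 0 \<and> \<sigma> > 0 \<and>
     (\<forall>x\<in>U. f x \<ge> f_low \<and> norm (grad f x) \<le> G) \<and>
     (\<forall>x\<in>U. \<forall>y\<in>U. norm (grad f x - grad f y) \<le> L_f * norm (x - y)) \<and>
     (\<forall>x\<in>U. spectral_norm (grad_mat c x) \<le> M) \<and>
     (\<forall>x\<in>U. \<forall>y\<in>U. spectral_norm (grad_mat c x - grad_mat c y) \<le> L_c * norm (x - y)) \<and>
     (\<forall>x\<in>U. \<forall>u. norm (grad_mat c x *v u) \<ge> \<sigma> * norm u)"

subsection \<open>NR-LALM\<close>

definition kappa_lin :: "real \<Rightarrow> real" where
  "kappa_lin L_c = L_c / 2"

definition C_mod :: "real \<Rightarrow> real \<Rightarrow> real \<Rightarrow> real \<Rightarrow> real \<Rightarrow> real \<Rightarrow> real" where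
  "C_mod L_f M L_c \<Delta> \<rho> \<Lambda> =
     L_f / 2 + kappa_lin L_c * (3 * \<Lambda> + \<rho> * M * \<Delta>) + \<rho> / 2 * (kappa_lin L_c)\<^sup>2 * \<Delta>\<^sup>2"

definition A_p :: "real \<Rightarrow> real \<Rightarrow> real \<Rightarrow> real \<Rightarrow> real \<Rightarrow> real" where
  "A_p M L_c \<Delta> \<beta> \<rho> = \<beta> + \<rho> * M * kappa_lin L_c * \<Delta>"

definition B_p :: "real \<Rightarrow> real \<Rightarrow> real \<Rightarrow> real \<Rightarrow> real \<Rightarrow> real \<Rightarrow> real \<Rightarrow> real" where
  "B_p L_f M L_c \<Delta> \<beta> \<rho> \<Lambda> = A_p M L_c \<Delta> \<beta> \<rho> + L_f + L_c * \<Lambda>"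

definition C_lam_p ::
  "real \<Rightarrow> real \<Rightarrow> real \<Rightarrow> real \<Rightarrow> real \<Rightarrow> real \<Rightarrow> real \<Rightarrow> real \<Rightarrow> real" where
  "C_lam_p L_f M L_c \<sigma> \<Delta> \<beta> \<rho> \<Lambda> =
     4 / \<sigma>\<^sup>2 * max ((A_p M L_c \<Delta> \<beta> \<rho>)\<^sup>2) ((B_p L_f M L_c \<Delta> \<beta> \<rho> \<Lambda>)\<^sup>2)"

definition base_inequalities ::
  "real \<Rightarrow> real \<Rightarrow> real \<Rightarrow> real \<Rightarrow> real \<Rightarrow> real \<Rightarrow> real \<Rightarrow> real \<Rightarrow> real \<Rightarrow> bool" where
  "base_inequalities G L_f M L_c \<sigma> \<Delta> \<beta> \<rho> \<Lambda> \<longleftrightarrow>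
     \<Lambda> \<ge> (G + \<beta> * \<Delta> + \<rho> * M * kappa_lin L_c * \<Delta>\<^sup>2) / \<sigma> \<and>
     G / \<beta> + 3 * M * \<Lambda> / (\<beta> + \<rho> * \<sigma>\<^sup>2) \<le> \<Delta> \<and>
     C_mod L_f M L_c \<Delta> \<rho> \<Lambda> \<le> 3 * \<beta> / 8 \<and>
     \<rho> \<ge> 8 * C_lam_p L_f M L_c \<sigma> \<Delta> \<beta> \<rho> \<Lambda> / \<beta>"

subsection \<open>NR-LALM+SOC\<close>

definition kappa_q :: "real \<Rightarrow> real \<Rightarrow> real" where
  "kappa_q L_c \<sigma> = L_c / (2 * \<sigma>)"

definition kappa_d :: "real \<Rightarrow> real \<Rightarrow> real" where
  "kappa_d L_c \<sigma> = L_c ^ 3 / (8 * \<sigma>\<^sup>2)"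

definition chi_cor :: "real \<Rightarrow> real \<Rightarrow> real \<Rightarrow> real" where
  "chi_cor L_c \<sigma> \<Delta> = 1 + kappa_q L_c \<sigma> * \<Delta>"

definition C_mod_cor ::
  "real \<Rightarrow> real \<Rightarrow> real \<Rightarrow> real \<Rightarrow> real \<Rightarrow> real \<Rightarrow> real \<Rightarrow> real \<Rightarrow> real" where
  "C_mod_cor G L_f M L_c \<sigma> \<Delta> \<rho> \<Lambda> =
     G * kappa_q L_c \<sigma> + L_f / 2 * (chi_cor L_c \<sigma> \<Delta>)\<^sup>2
     + kappa_d L_c \<sigma> * \<Delta>\<^sup>2 * (3 * \<Lambda> + \<rho> * M * \<Delta>) + \<rho> / 2 * (kappa_d L_c \<sigma>)\<^sup>2 * \<Delta> ^ 6"

definition A_p_cor :: "real \<Rightarrow> real \<Rightarrow> real \<Rightarrow> real \<Rightarrow> real \<Rightarrow> real \<Rightarrow> real" where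
  "A_p_cor M L_c \<sigma> \<Delta> \<beta> \<rho> = \<beta> + \<rho> * M * kappa_d L_c \<sigma> * \<Delta> ^ 3"

definition B_p_cor ::
  "real \<Rightarrow> real \<Rightarrow> real \<Rightarrow> real \<Rightarrow> real \<Rightarrow> real \<Rightarrow> real \<Rightarrow> real \<Rightarrow> real" where
  "B_p_cor L_f M L_c \<sigma> \<Delta> \<beta> \<rho> \<Lambda> =
     A_p_cor M L_c \<sigma> \<Delta> \<beta> \<rho> + (L_f + L_c * \<Lambda>) * chi_cor L_c \<sigma> \<Delta>"

definition C_lam_p_cor ::
  "real \<Rightarrow> real \<Rightarrow> real \<Rightarrow> real \<Rightarrow> real \<Rightarrow> real \<Rightarrow> real \<Rightarrow> real \<Rightarrow> real" where
  "C_lam_p_cor L_f M L_c \<sigma> \<Delta> \<beta> \<rho> \<Lambda> =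
     4 / \<sigma>\<^sup>2 * max ((A_p_cor M L_c \<sigma> \<Delta> \<beta> \<rho>)\<^sup>2) ((B_p_cor L_f M L_c \<sigma> \<Delta> \<beta> \<rho> \<Lambda>)\<^sup>2)"

definition corrected_inequalities ::
  "real \<Rightarrow> real \<Rightarrow> real \<Rightarrow> real \<Rightarrow> real \<Rightarrow> real \<Rightarrow> real \<Rightarrow> real \<Rightarrow> real \<Rightarrow> bool" where
  "corrected_inequalities G L_f M L_c \<sigma> \<Delta> \<beta> \<rho> \<Lambda> \<longleftrightarrow>
     \<Lambda> \<ge> (G + \<beta> * \<Delta> + \<rho> * M * kappa_d L_c \<sigma> * \<Delta> ^ 4) / \<sigma> \<and>
     G / \<beta> + 3 * M * \<Lambda> / (\<beta> + \<rho> * \<sigma>\<^sup>2) \<le> \<Delta> \<and>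
     C_mod_cor G L_f M L_c \<sigma> \<Delta> \<rho> \<Lambda> \<le> 3 * \<beta> / 8 \<and>
     \<rho> \<ge> 8 * C_lam_p_cor L_f M L_c \<sigma> \<Delta> \<beta> \<rho> \<Lambda> / \<beta>"

subsection \<open>Certification under global regularity\<close>

definition init_conditions ::
  "(real^'n \<Rightarrow> real^'m) \<Rightarrow> real \<Rightarrow> real \<Rightarrow> real^'n \<Rightarrow> real^'m \<Rightarrow> bool" where
  "init_conditions c \<rho> \<Lambda> x0 lam0 \<longleftrightarrow> norm lam0 \<le> \<Lambda> \<and> \<rho> * norm (c x0) \<le> \<Lambda>"

text \<open>The two certification predicates are meant for domain \<open>UNIV\<close> only, where the
  localization requirements are void.  Positivity of the parameters is not built in.\<close>

definition certified_base ::
  "(real^'n \<Rightarrow> real^'m) \<Rightarrow> real \<Rightarrow> real \<Rightarrow> real \<Rightarrow> real \<Rightarrow> real \<Rightarrow>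
   real \<Rightarrow> real \<Rightarrow> real \<Rightarrow> real \<Rightarrow> real^'n \<Rightarrow> real^'m \<Rightarrow> bool" where
  "certified_base c G L_f M L_c \<sigma> \<Delta> \<beta> \<rho> \<Lambda> x0 lam0 \<longleftrightarrow>
     base_inequalities G L_f M L_c \<sigma> \<Delta> \<beta> \<rho> \<Lambda> \<and> init_conditions c \<rho> \<Lambda> x0 lam0"

definition certified_corrected ::
  "(real^'n \<Rightarrow> real^'m) \<Rightarrow> real \<Rightarrow> real \<Rightarrow> real \<Rightarrow> real \<Rightarrow> real \<Rightarrow>
   real \<Rightarrow> real \<Rightarrow> real \<Rightarrow> real \<Rightarrow> real^'n \<Rightarrow> real^'m \<Rightarrow> bool" where
  "certified_corrected c G L_f M L_c \<sigma> \<Delta> \<beta> \<rho> \<Lambda> x0 lam0 \<longleftrightarrow>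
     corrected_inequalities G L_f M L_c \<sigma> \<Delta> \<beta> \<rho> \<Lambda> \<and> init_conditions c \<rho> \<Lambda> x0 lam0"

end

(* With q = kappa_q * Delta one has kappa_d * Delta^2 = kappa_lin * q^2. Substituting the lower bound
   on Lambda into the base bound on C_mod forces q \<le> 1/8, so every term of the base inequalities
   containing kappa_lin shrinks by a factor of at least 64 in the corrected ones. This gain pays for the new
   factor chi = 1 + q: in C_mod because 3 kappa_lin Lambda \<ge> 3 kappa_q G + 3 beta q, and in B_p because
   L_f + L_c Lambda \<le> beta, while rho sigma M \<ge> rho sigma^2 \<ge> 32 beta.
   For strictness, f = 0 and c = id with G = M = sigma = beta = 1, L_c = 1/6 and rho = 150: the base
   inequalities force Delta \<ge> 1 and hence kappa_lin rho M Delta \<ge> 25/2 inside C_mod \<le> 3/8, whereas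
   at Delta = 11/10 the factor q^2 < 1/100 makes the corresponding corrected term harmless. *)
theory Submission
  imports Defs
begin

lemma kappa_d_eq: "kappa_d L_c \<sigma> * \<Delta>\<^sup>2 = kappa_lin L_c * (kappa_q L_c \<sigma> * \<Delta>)\<^sup>2"
  by (simp add: kappa_d_def kappa_lin_def kappa_q_def power2_eq_square power3_eq_cube)

text \<open>Pure real arithmetic: the functions enter only through
  \<open>\<sigma> \<le> M\<close>.\<close>

lemma base_imp_corrected:
  assumes pos: "G > 0" "L_f > 0" "M > 0" "L_c > 0" "\<sigma> > 0" "\<Delta> > 0" "\<beta> > 0" "\<rho> > 0" "\<Lambda> > 0"
    and "\<sigma> \<le> M"
    and base: "base_inequalities G L_f M L_c \<sigma> \<Delta> \<beta> \<rho> \<Lambda>"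
  shows "corrected_inequalities G L_f M L_c \<sigma> \<Delta> \<beta> \<rho> \<Lambda>"
proof -
  define \<kappa> where "\<kappa> = kappa_lin L_c"
  define q where "q = kappa_q L_c \<sigma> * \<Delta>"
  define r where "r = q\<^sup>2"
  have \<kappa>: "\<kappa> > 0" and q: "q > 0" and L_c: "L_c = 2 * \<kappa>"
    using pos by (auto simp: \<kappa>_def q_def kappa_lin_def kappa_q_def)
  have \<kappa>\<Delta>: "\<kappa> * \<Delta> = \<sigma> * q"
    using pos by (simp add: \<kappa>_def q_def kappa_lin_def kappa_q_def)
  have \<kappa>_d: "kappa_d L_c \<sigma> * \<Delta>\<^sup>2 = \<kappa> * r"
    unfolding \<kappa>_def q_def r_def by (rule kappa_d_eq)
  have G\<kappa>_q: "\<kappa> * (G / \<sigma>) = G * kappa_q L_c \<sigma>"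
    by (simp add: \<kappa>_def kappa_lin_def kappa_q_def)
  have r0: "r \<ge> 0" by (simp add: r_def)
  from base have \<Lambda>: "\<Lambda> \<ge> (G + \<beta> * \<Delta> + \<rho> * M * \<kappa> * \<Delta>\<^sup>2) / \<sigma>"
    and \<Delta>: "G / \<beta> + 3 * M * \<Lambda> / (\<beta> + \<rho> * \<sigma>\<^sup>2) \<le> \<Delta>"
    and mod: "L_f / 2 + \<kappa> * (3 * \<Lambda> + \<rho> * M * \<Delta>) + \<rho> / 2 * \<kappa>\<^sup>2 * \<Delta>\<^sup>2 \<le> 3 * \<beta> / 8"
    and lam: "\<rho> \<ge> 8 * C_lam_p L_f M L_c \<sigma> \<Delta> \<beta> \<rho> \<Lambda> / \<beta>"
    by (auto simp: base_inequalities_def C_mod_def \<kappa>_def)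

  \<comment> \<open>Multiplying the bound on \<open>\<Lambda>\<close> by \<open>\<kappa>\<close>
    converts \<open>G / \<sigma>\<close> into \<open>G * kappa_q L_c \<sigma>\<close> and
    \<open>\<beta> * \<Delta> / \<sigma>\<close> into \<open>\<beta> * q\<close>.\<close>
  have "G / \<sigma> + \<beta> * \<Delta> / \<sigma> \<le> (G + \<beta> * \<Delta> + \<rho> * M * \<kappa> * \<Delta>\<^sup>2) / \<sigma>"
    using pos \<kappa> by (simp add: field_simps)
  then have "\<kappa> * (G / \<sigma> + \<beta> * \<Delta> / \<sigma>) \<le> \<kappa> * \<Lambda>"
    using \<Lambda> \<kappa> by (intro mult_left_mono) auto
  moreover have "\<kappa> * (\<beta> * \<Delta> / \<sigma>) = \<beta> * q"
    using \<kappa>\<Delta> pos by (simp add: field_simps)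
  ultimately have \<kappa>\<Lambda>: "\<kappa> * \<Lambda> \<ge> G * kappa_q L_c \<sigma> + \<beta> * q"
    using G\<kappa>_q by (simp add: algebra_simps)
  have G\<kappa>_q_pos: "G * kappa_q L_c \<sigma> > 0"
    using pos by (simp add: kappa_q_def)
  define S where "S = \<kappa> * (\<rho> * M * \<Delta>)"
  define T where "T = \<rho> / 2 * \<kappa>\<^sup>2 * \<Delta>\<^sup>2"
  have S: "S > 0" and T: "T > 0" using pos \<kappa> by (auto simp: S_def T_def)
  have mod': "L_f / 2 + 3 * (\<kappa> * \<Lambda>) + S + T \<le> 3 * \<beta> / 8"
    using mod by (simp add: S_def T_def algebra_simps)
  \<comment> \<open>In \<open>mod'\<close> the summand \<open>3 * (\<kappa> * \<Lambda>)\<close> is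
    at least \<open>3 * (\<beta> * q)\<close> and the others are positive, so
    \<open>3 * \<beta> * q \<le> 3 * \<beta> / 8\<close>.\<close>
  have "\<beta> * q \<le> \<beta> * (1 / 8)" using mod' \<kappa>\<Lambda> G\<kappa>_q_pos S T pos by linarith
  then have q8: "q \<le> 1 / 8" using pos mult_le_cancel_left_pos by blast
  have "r \<le> q * (1 / 8)"
    unfolding r_def power2_eq_square using q q8 by (intro mult_left_mono) auto
  then have r64: "r \<le> q / 8" "r \<le> 1 / 64"
    using q8 by simp_all
  have "\<kappa> * \<Lambda> > 0" "\<beta> * q > 0" using pos \<kappa> q by auto
  then have L_f: "L_f \<le> 3 * \<beta> / 4" using mod' S T by linarith

  have "\<rho> * M * kappa_d L_c \<sigma> * \<Delta> ^ 4 = r * (\<rho> * M * \<kappa> * \<Delta>\<^sup>2)"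
  proof -
    have "\<rho> * M * kappa_d L_c \<sigma> * \<Delta> ^ 4 = \<rho> * M * (kappa_d L_c \<sigma> * \<Delta>\<^sup>2) * \<Delta>\<^sup>2"
      by (simp add: power2_eq_square power4_eq_xxxx mult_ac)
    then show ?thesis unfolding \<kappa>_d by (simp only: mult_ac)
  qed
  also have "\<dots> \<le> 1 * (\<rho> * M * \<kappa> * \<Delta>\<^sup>2)"
    using r64 pos \<kappa> by (intro mult_right_mono) auto
  finally have "(G + \<beta> * \<Delta> + \<rho> * M * kappa_d L_c \<sigma> * \<Delta> ^ 4) / \<sigma>
      \<le> (G + \<beta> * \<Delta> + \<rho> * M * \<kappa> * \<Delta>\<^sup>2) / \<sigma>"
    using pos by (intro divide_right_mono) auto
  then have 1: "\<Lambda> \<ge> (G + \<beta> * \<Delta> + \<rho> * M * kappa_d L_c \<sigma> * \<Delta> ^ 4) / \<sigma>"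
    using \<Lambda> by linarith

  have mod_cor: "C_mod_cor G L_f M L_c \<sigma> \<Delta> \<rho> \<Lambda> =
      G * kappa_q L_c \<sigma> + L_f / 2 * (1 + q)\<^sup>2 + r * (3 * (\<kappa> * \<Lambda>) + S) + r\<^sup>2 * T"
  proof -
    have "\<rho> / 2 * (kappa_d L_c \<sigma>)\<^sup>2 * \<Delta> ^ 6 = \<rho> / 2 * (kappa_d L_c \<sigma> * \<Delta>\<^sup>2)\<^sup>2 * \<Delta>\<^sup>2"
      by (simp add: power_mult_distrib flip: power_mult power_add)
    then show ?thesis
      unfolding C_mod_cor_def chi_cor_def \<kappa>_d q_def[symmetric] S_def T_def
      by (simp add: power_mult_distrib algebra_simps)
  qed
  define X where "X = L_f / 2 * (1 + q)\<^sup>2"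
  define Y where "Y = r * (3 * (\<kappa> * \<Lambda>) + S)"
  define Z where "Z = r\<^sup>2 * T"
  \<comment> \<open>Here \<open>(1 + q)\<^sup>2 = 1 + 2 * q + r\<close>, and
    \<open>r / 2 \<le> q / 16\<close> gives 17/16; then 3/4 * 17/16 = 51/64.\<close>
  have "L_f * (q + r / 2) \<le> 3 * \<beta> / 4 * (17 / 16 * q)"
    using L_f r64 q r0 pos by (intro mult_mono) auto
  moreover have "X = L_f / 2 + L_f * (q + r / 2)"
    by (simp add: X_def r_def power2_eq_square algebra_simps)
  ultimately have "X \<le> L_f / 2 + 51 / 64 * (\<beta> * q)"
    by simp
  moreover have "Y \<le> 1 / 64 * (3 * (\<kappa> * \<Lambda>) + S)"
    unfolding Y_def using r64 S \<kappa> pos by (intro mult_right_mono) auto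
  moreover have "Z \<le> 1 * T"
    unfolding Z_def using r64 r0 T by (intro mult_right_mono) (auto intro: power_le_one)
  \<comment> \<open>Of the three copies of \<open>\<kappa> * \<Lambda>\<close> in
    \<open>mod'\<close>, one pays for \<open>G * kappa_q L_c \<sigma>\<close> and 51/64 of
    \<open>\<beta> * q\<close>; the other two exceed the 3/64 left in \<open>Y\<close>.\<close>
  ultimately have 3: "C_mod_cor G L_f M L_c \<sigma> \<Delta> \<rho> \<Lambda> \<le> 3 * \<beta> / 8"
    unfolding mod_cor X_def[symmetric] Y_def[symmetric] Z_def[symmetric]
    using mod' \<kappa>\<Lambda> \<open>\<beta> * q > 0\<close> G\<kappa>_q_pos S by argo

  define A where "A = A_p M L_c \<Delta> \<beta> \<rho>"
  define B where "B = B_p L_f M L_c \<Delta> \<beta> \<rho> \<Lambda>"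
  define A' where "A' = A_p_cor M L_c \<sigma> \<Delta> \<beta> \<rho>"
  define B' where "B' = B_p_cor L_f M L_c \<sigma> \<Delta> \<beta> \<rho> \<Lambda>"
  have A: "A = \<beta> + S"
    by (simp add: A_def A_p_def S_def \<kappa>_def)
  have B: "B = A + (L_f + 2 * (\<kappa> * \<Lambda>))"
    by (simp add: A_def B_def B_p_def L_c)
  have A': "A' = \<beta> + r * S"
  proof -
    have "\<rho> * M * kappa_d L_c \<sigma> * \<Delta> ^ 3 = \<rho> * M * (kappa_d L_c \<sigma> * \<Delta>\<^sup>2) * \<Delta>"
      by (simp add: power2_eq_square power3_eq_cube)
    then show ?thesis unfolding A'_def A_p_cor_def \<kappa>_d S_def by (simp only: mult_ac)
  qed
  have B': "B' = A' + (L_f + 2 * (\<kappa> * \<Lambda>)) * (1 + q)"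
    by (simp add: A'_def B'_def B_p_cor_def chi_cor_def q_def L_c)
  have rS: "r * S \<le> 1 / 64 * S"
    using r64 S by (intro mult_right_mono) auto
  have A'A: "0 \<le> A'" "A' \<le> A"
    using rS S r0 pos by (auto simp: A A')

  \<comment> \<open>Bounding the maximum below by \<open>\<beta>\<^sup>2\<close> reduces the
    condition on \<open>\<rho>\<close> to
    \<open>32 * \<beta> \<le> \<rho> * \<sigma>\<^sup>2\<close>, with 32 = 8 * 4.\<close>
  have "A\<^sup>2 \<ge> \<beta>\<^sup>2"
    using A S pos by (intro power_mono) auto
  then have max: "max (A\<^sup>2) (B\<^sup>2) \<ge> \<beta>\<^sup>2" by simp
  have "8 * (4 / \<sigma>\<^sup>2 * \<beta>\<^sup>2) / \<beta> \<le> 8 * (4 / \<sigma>\<^sup>2 * max (A\<^sup>2) (B\<^sup>2)) / \<beta>"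
    using max pos by (intro divide_right_mono mult_left_mono) auto
  also have "\<dots> \<le> \<rho>"
    using lam by (simp add: C_lam_p_def A_def B_def)
  finally have "32 * \<beta> \<le> \<rho> * \<sigma>\<^sup>2"
    using pos by (simp add: field_simps power2_eq_square)
  also have "\<dots> \<le> \<rho> * M * \<sigma>"
    using \<open>\<sigma> \<le> M\<close> pos by (simp add: power2_eq_square mult_left_mono mult_right_mono)
  finally have "32 * \<beta> * q \<le> \<rho> * M * \<sigma> * q"
    using q by (intro mult_right_mono) auto
  also have "\<dots> = S"
    unfolding S_def using \<kappa>\<Delta> by (simp add: mult.commute mult.left_commute)
  finally have S32: "32 * (\<beta> * q) \<le> S" by simp
  \<comment> \<open>Adding \<open>L_f / 2 \<le> 3 * \<beta> / 8\<close> to \<open>mod'\<close> even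
    gives the bound 3/4 of \<open>\<beta>\<close>.\<close>
  have "L_f + 2 * (\<kappa> * \<Lambda>) \<le> \<beta>"
    using mod' \<open>L_f > 0\<close> \<open>\<kappa> * \<Lambda> > 0\<close> L_f S T by linarith
  then have "(L_f + 2 * (\<kappa> * \<Lambda>)) * q \<le> \<beta> * q"
    using q by (intro mult_right_mono) auto
  \<comment> \<open>Passing from \<open>B\<close> to \<open>B'\<close> adds at most
    \<open>\<beta> * q\<close> and saves at least 63/64 of \<open>S\<close>, which is far larger by
    \<open>S32\<close>.\<close>
  then have B'B: "B' \<le> B"
    unfolding A A' B B' distrib_left mult_1_right using S32 rS S by linarith
  have "0 \<le> B'"
    using A'A pos \<kappa> q by (auto simp: B')
  then have "max (A'\<^sup>2) (B'\<^sup>2) \<le> max (A\<^sup>2) (B\<^sup>2)"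
    using A'A B'B by (intro max.mono power_mono)
  then have "8 * (4 / \<sigma>\<^sup>2 * max (A'\<^sup>2) (B'\<^sup>2)) / \<beta> \<le> 8 * (4 / \<sigma>\<^sup>2 * max (A\<^sup>2) (B\<^sup>2)) / \<beta>"
    using pos by (intro divide_right_mono mult_left_mono) auto
  then have 4: "\<rho> \<ge> 8 * C_lam_p_cor L_f M L_c \<sigma> \<Delta> \<beta> \<rho> \<Lambda> / \<beta>"
    using lam unfolding C_lam_p_def C_lam_p_cor_def A_def B_def A'_def B'_def by linarith
  show ?thesis
    using 1 \<Delta> 3 4 by (simp add: corrected_inequalities_def)
qed

text \<open>At any point of the nonempty \<open>U\<close>, a unit vector is stretched by at least
  \<open>\<sigma>\<close> and at most \<open>M\<close>. Such a vector exists because the index type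
  is nonempty, which is the hypothesis m \<ge> 1.\<close>

lemma regularity_sigma_le_M:
  assumes "regularity (f :: real^'n \<Rightarrow> real) (c :: real^'n \<Rightarrow> real^'m) U f_low G L_f M L_c \<sigma>"
  shows "\<sigma> \<le> M"
proof -
  from assms obtain x where "x \<in> U" by (auto simp: regularity_def)
  with assms have M: "spectral_norm (grad_mat c x) \<le> M"
    and \<sigma>: "\<And>u. \<sigma> * norm u \<le> norm (grad_mat c x *v u)"
    by (auto simp: regularity_def)
  obtain u :: "real^'m" where u: "norm u = 1"
    using vector_choose_size[of 1] by auto
  have "\<sigma> \<le> norm (grad_mat c x *v u)" using \<sigma>[of u] u by simp
  also have "\<dots> \<le> spectral_norm (grad_mat c x) * norm u"
    unfolding spectral_norm_def by (rule onorm) simp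
  finally show ?thesis using M u by simp
qed

lemma regularity_base_imp_corrected:
  assumes "regularity (f :: real^'n \<Rightarrow> real) (c :: real^'n \<Rightarrow> real^'m) U f_low G L_f M L_c \<sigma>"
    and "\<Delta> > 0" "\<beta> > 0" "\<rho> > 0" "\<Lambda> > 0" "base_inequalities G L_f M L_c \<sigma> \<Delta> \<beta> \<rho> \<Lambda>"
  shows "corrected_inequalities G L_f M L_c \<sigma> \<Delta> \<beta> \<rho> \<Lambda>"
  using assms regularity_sigma_le_M[OF assms(1)]
  by (intro base_imp_corrected) (auto simp: regularity_def)

text \<open>Uniqueness of the derivative makes the definite description in \<open>grad\<close>
  computable.\<close>

lemma grad_eqI:
  assumes "GDERIV f x :> D"
  shows "grad f x = D"
  unfolding grad_def
proof (rule the_equality)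
  show "GDERIV f x :> D" by (fact assms)
next
  fix E assume "GDERIV f x :> E"
  then have "(\<lambda>h. h \<bullet> E) = (\<lambda>h. h \<bullet> D)"
    using assms unfolding gderiv_def by (rule has_derivative_unique)
  then show "E = D"
    by (metis inner_commute vector_eq_rdot)
qed

lemma grad_const: "grad (\<lambda>x. a) = (\<lambda>x. 0)"
  by (rule ext, rule grad_eqI) (rule GDERIV_const)

lemma grad_component: "grad (\<lambda>x :: real^'n. x $ j) = (\<lambda>x. axis j 1)"
proof
  fix x :: "real^'n"
  show "grad (\<lambda>x. x $ j) x = axis j 1"
    by (rule grad_eqI)
      (simp add: gderiv_def inner_axis bounded_linear.has_derivative[OF bounded_linear_vec_nth])
qed

lemma grad_mat_id: "grad_mat (\<lambda>x. x) x = mat 1"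
  by (simp add: grad_mat_def grad_component mat_def axis_def vec_eq_iff)

lemma spectral_norm_mat_1: "spectral_norm (mat 1 :: real^'n^'n) \<le> 1"
  unfolding spectral_norm_def by (rule onorm_le) simp

lemma spectral_norm_zero: "spectral_norm (0 :: real^'m^'n) = 0"
proof -
  have "(*v) (0 :: real^'m^'n) = (\<lambda>x. 0)" by auto
  then show ?thesis by (simp add: spectral_norm_def onorm_zero)
qed

text \<open>Both gradients are constant, so the Lipschitz bounds hold with any positive
  \<open>L_f\<close> and \<open>L_c\<close>. This freedom lets the strictness example choose its
  constants.\<close>

lemma regularity_zero_id:
  assumes "G > 0" "L_f > 0" "L_c > 0"
  shows "regularity (\<lambda>x :: real^'n. 0) (\<lambda>x. x) UNIV 0 G L_f 1 L_c 1"
  using assms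
  by (simp add: regularity_def C1_on_def grad_const grad_component grad_mat_id
      spectral_norm_mat_1 spectral_norm_zero bounded_linear_imp_differentiable bounded_linear_vec_nth)

text \<open>With \<open>\<Lambda>\<close> = 5/2 the second inequality needs \<open>\<Delta>\<close>
  \<ge> 1 + 7.5/151, about 1.05, which 11/10 meets; the first then needs \<open>\<Lambda>\<close>
  only above about 2.23.\<close>

lemma corrected_example: "corrected_inequalities 1 (1/100) 1 (1/6) 1 (11/10) 1 150 (5/2)"
  by (simp add: corrected_inequalities_def C_mod_cor_def C_lam_p_cor_def A_p_cor_def B_p_cor_def
      chi_cor_def kappa_d_def kappa_q_def power_divide)

lemma not_base_example:
  assumes "\<Delta> > 0" "\<Lambda> > 0"
  shows "\<not> base_inequalities 1 (1/100) 1 (1/6) 1 \<Delta> 1 150 \<Lambda>"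
proof
  assume "base_inequalities 1 (1/100) 1 (1/6) 1 \<Delta> 1 150 \<Lambda>"
  \<comment> \<open>Here \<open>kappa_lin\<close> is 1/12, and 25/48 = 75 / 144.\<close>
  then have \<Delta>: "1 + 3 * \<Lambda> / 151 \<le> \<Delta>"
    and mod: "1/200 + (3 * \<Lambda> + 150 * \<Delta>) / 12 + 25/48 * \<Delta>\<^sup>2 \<le> 3/8"
    by (auto simp: power_divide base_inequalities_def C_mod_def kappa_lin_def)
  have "\<Delta> \<ge> 1" using \<Delta> assms by linarith
  moreover have "\<Delta>\<^sup>2 \<ge> 0" by simp
  ultimately show False using mod assms by argo
qed

theorem proposition4p1:
  shows
    "(\<forall>(f :: real^'n \<Rightarrow> real) (c :: real^'n \<Rightarrow> real^'m) U f_low G L_f M L_c \<sigma>.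
        regularity f c U f_low G L_f M L_c \<sigma> \<longrightarrow>
        (\<forall>\<Delta>>0. \<forall>\<beta>>0. \<forall>\<rho>>0. \<forall>\<Lambda>>0.
           base_inequalities G L_f M L_c \<sigma> \<Delta> \<beta> \<rho> \<Lambda> \<longrightarrow>
           corrected_inequalities G L_f M L_c \<sigma> \<Delta> \<beta> \<rho> \<Lambda>))
     \<and>
     (\<forall>(f :: real^'n \<Rightarrow> real) (c :: real^'n \<Rightarrow> real^'m) f_low G L_f M L_c \<sigma>.
        regularity f c UNIV f_low G L_f M L_c \<sigma> \<longrightarrow>
        (\<forall>\<Delta>>0. \<forall>\<beta>>0. \<forall>\<rho>>0. \<forall>\<Lambda>>0. \<forall>x0 lam0.
           certified_base c G L_f M L_c \<sigma> \<Delta> \<beta> \<rho> \<Lambda> x0 lam0 \<longrightarrow>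
           certified_corrected c G L_f M L_c \<sigma> \<Delta> \<beta> \<rho> \<Lambda> x0 lam0))
     \<and>
     (\<exists>(f :: real^1 \<Rightarrow> real) (c :: real^1 \<Rightarrow> real^1) f_low G L_f M L_c \<sigma>.
        regularity f c UNIV f_low G L_f M L_c \<sigma> \<and>
        (\<exists>\<beta>>0. \<exists>\<rho>>0. \<exists>x0 lam0.
           (\<exists>\<Delta>>0. \<exists>\<Lambda>>0. certified_corrected c G L_f M L_c \<sigma> \<Delta> \<beta> \<rho> \<Lambda> x0 lam0) \<and>
           \<not> (\<exists>\<Delta>'>0. \<exists>\<Lambda>'>0. certified_base c G L_f M L_c \<sigma> \<Delta>' \<beta> \<rho> \<Lambda>' x0 lam0)))"
proof (intro conjI allI impI)
  have "regularity (\<lambda>x :: real^1. 0) (\<lambda>x. x) UNIV 0 1 (1/100) 1 (1/6) 1"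
    by (rule regularity_zero_id) auto
  \<comment> \<open>The zero initial pair makes the initialization conditions hold for every
    positive \<open>\<Lambda>\<close>, so only the inequalities separate the two methods.\<close>
  moreover have "certified_corrected (\<lambda>x :: real^1. x) 1 (1/100) 1 (1/6) 1 (11/10) 1 150 (5/2) 0
      (0 :: real^1)"
    by (simp add: certified_corrected_def init_conditions_def corrected_example)
  moreover have "\<not> certified_base (\<lambda>x :: real^1. x) 1 (1/100) 1 (1/6) 1 \<Delta> 1 150 \<Lambda> 0 (0 :: real^1)"
    if "\<Delta> > 0" "\<Lambda> > 0" for \<Delta> \<Lambda>
    using not_base_example[OF that] by (simp add: certified_base_def)
  ultimately show "\<exists>(f :: real^1 \<Rightarrow> real) (c :: real^1 \<Rightarrow> real^1) f_low G L_f M L_c \<sigma>.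
        regularity f c UNIV f_low G L_f M L_c \<sigma> \<and>
        (\<exists>\<beta>>0. \<exists>\<rho>>0. \<exists>x0 lam0.
           (\<exists>\<Delta>>0. \<exists>\<Lambda>>0. certified_corrected c G L_f M L_c \<sigma> \<Delta> \<beta> \<rho> \<Lambda> x0 lam0) \<and>
           \<not> (\<exists>\<Delta>'>0. \<exists>\<Lambda>'>0. certified_base c G L_f M L_c \<sigma> \<Delta>' \<beta> \<rho> \<Lambda>' x0 lam0))"
    apply -
    apply (rule exI[of _ "\<lambda>x. 0"], rule exI[of _ "\<lambda>x. x"])
    apply (rule exI[of _ 0], rule exI[of _ 1], rule exI[of _ "1/100"], rule exI[of _ 1])
    apply (rule exI[of _ "1/6"], rule exI[of _ 1], rule conjI, assumption)
    apply (rule exI[of _ 1], rule conjI, simp, rule exI[of _ 150], rule conjI, simp)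
    apply (rule exI[of _ 0], rule exI[of _ 0], rule conjI)
     apply (rule exI[of _ "11/10"], rule conjI, simp, rule exI[of _ "5/2"], rule conjI, simp)
     apply assumption
    apply blast
    done
qed (auto simp: certified_base_def certified_corrected_def dest: regularity_base_imp_corrected)

end
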